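(* Let $\Omega\subseteq\mathbb{R}^d$ be a bounded Borel set, let $\varrho$ be a Borel probability measure on $\Omega$, let $f,g\in C(\bar\Omega)$ be real-valued, and let $\mu=f_*\varrho$ and $\nu=g_*\varrho$. Then $$\left|\mathbb{E}_\varrho f-\mathbb{E}_\varrho g\right|\le W_1(\mu,\nu)\le\|f-g\|_{L^1(\Omega,\varrho)}.$$ Moreover, if $f\ge g$ $\varrho$-almost everywhere, then $$W_1(\mu,\nu)=\|f-g\|_{L^1(\Omega,\varrho)}.$$
   Context: $\mathbb{E}_\varrho f=\int_\Omega f\,d\varrho$. The pushforward is $f_*\varrho(B)=\varrho(f^{-1}(B))$ for Borel $B\subseteq\mathbb{R}$. For Borel probability measures $\mu,\nu$ on $\mathbb{R}$ with finite first moments, $W_1(\mu,\nu)=\inf_{\gamma\in\Gamma}\int_{\mathbb{R}^2}|x-y|\,d\gamma(x,y)$, where $\Gamma$ is the set of Borel measures on $\mathbb{R}^2$ whose first and second marginals are $\mu$ and $\nu$. *)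

theory Defs
  imports "HOL-Probability.Probability"
begin

definition couplings :: "real measure \<Rightarrow> real measure \<Rightarrow> (real \<times> real) measure set" where
  "couplings \<mu> \<nu> =
     {\<gamma>. sets \<gamma> = sets borel \<and> distr \<gamma> borel fst = \<mu> \<and> distr \<gamma> borel snd = \<nu>}"

(* The values are in [0,\<infinity>]: the nonnegative integral gives a non-integrable cost the value
   \<infinity>, where the Bochner integral would give 0. *)
definition wasserstein1 :: "real measure \<Rightarrow> real measure \<Rightarrow> ennreal" where
  "wasserstein1 \<mu> \<nu> = (INF \<gamma>\<in>couplings \<mu> \<nu>. \<integral>\<^sup>+ (x, y). ennreal \<bar>x - y\<bar> \<partial>\<gamma>)"

definition L1_norm :: "'a measure \<Rightarrow> ('a \<Rightarrow> real) \<Rightarrow> ennreal" where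
  "L1_norm M h = (\<integral>\<^sup>+ x. ennreal \<bar>h x\<bar> \<partial>M)"

end

theory Submission
  imports Defs
begin

text \<open>Integrating \<open>fst p - snd p\<close> against any coupling gives the same number, the
  difference of the two means, because the integral of each coordinate depends only on its marginal.
  Moving the absolute value inside the integral bounds this number by the cost of every coupling,
  hence by the infimum (\<open>mean_diff_le_wasserstein1\<close>). Conversely, the joint law of (f,
  g) under \<rho> is a coupling whose cost is exactly the L1 distance
  (\<open>wasserstein1_distr_le_L1_norm\<close>). If f \<ge> g almost everywhere, the L1 distance is
  the integral of f - g, so the outer terms of the chain agree and squeeze W1 between them.
  Compactness of the closure of \<Omega> makes all the means finite
  (\<open>continuous_on_closure_integrable\<close>).\<close>

lemma mean_diff_le_wasserstein1:
  assumes "integrable \<mu> (\<lambda>x. x)" and "integrable \<nu> (\<lambda>x. x)"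
  shows "ennreal \<bar>(\<integral>x. x \<partial>\<mu>) - (\<integral>x. x \<partial>\<nu>)\<bar> \<le> wasserstein1 \<mu> \<nu>"
  unfolding wasserstein1_def
proof (rule INF_greatest)
  fix \<gamma> assume "\<gamma> \<in> couplings \<mu> \<nu>"
  then have sets: "sets \<gamma> = sets borel"
    and \<mu>: "\<mu> = distr \<gamma> borel fst" and \<nu>: "\<nu> = distr \<gamma> borel snd"
    by (auto simp: couplings_def)
  have [measurable]: "fst \<in> borel_measurable \<gamma>" "snd \<in> borel_measurable \<gamma>"
    by (auto simp: measurable_cong_sets[OF sets refl]
        intro!: borel_measurable_continuous_onI continuous_intros)
  \<comment> \<open>The first moments of the marginals are those of the coordinates under \<gamma>;
    with both finite, the Bochner integral of the difference splits.\<close>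
  have int: "integrable \<gamma> fst" "integrable \<gamma> snd"
    using assms[unfolded \<mu> \<nu>] by (auto dest!: integrable_distr[rotated])
  have "\<bar>(\<integral>x. x \<partial>\<mu>) - (\<integral>x. x \<partial>\<nu>)\<bar> = norm (\<integral>p. fst p - snd p \<partial>\<gamma>)"
    unfolding \<mu> \<nu> using int by (simp add: integral_distr)
  also have "ennreal \<dots> \<le> (\<integral>\<^sup>+ p. norm (fst p - snd p) \<partial>\<gamma>)"
    using int by (intro integral_norm_bound_ennreal) auto
  finally show "ennreal \<bar>(\<integral>x. x \<partial>\<mu>) - (\<integral>x. x \<partial>\<nu>)\<bar> \<le> (\<integral>\<^sup>+ (x, y). ennreal \<bar>x - y\<bar> \<partial>\<gamma>)"
    by (simp add: case_prod_beta')
qed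

lemma wasserstein1_distr_le_L1_norm:
  assumes [measurable]: "f \<in> borel_measurable M" "g \<in> borel_measurable M"
  shows "wasserstein1 (distr M borel f) (distr M borel g) \<le> L1_norm M (\<lambda>x. f x - g x)"
proof -
  \<comment> \<open>The joint law of f and g: it moves the mass at f x to g x, at cost
    \<open>\<bar>f x - g x\<bar>\<close>.\<close>
  let ?\<gamma> = "distr M borel (\<lambda>x. (f x, g x))"
  have [measurable]: "(\<lambda>x. (f x, g x)) \<in> M \<rightarrow>\<^sub>M borel"
    by (rule borel_measurable_Pair) auto
  have [measurable]: "(fst :: real \<times> real \<Rightarrow> real) \<in> borel_measurable borel"
    "(snd :: real \<times> real \<Rightarrow> real) \<in> borel_measurable borel"
    by (auto intro!: borel_measurable_continuous_onI continuous_intros)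
  have "?\<gamma> \<in> couplings (distr M borel f) (distr M borel g)"
    by (simp add: couplings_def distr_distr comp_def)
  then have "wasserstein1 (distr M borel f) (distr M borel g) \<le> (\<integral>\<^sup>+ (x, y). ennreal \<bar>x - y\<bar> \<partial>?\<gamma>)"
    unfolding wasserstein1_def by (rule INF_lower)
  also have "\<dots> = L1_norm M (\<lambda>x. f x - g x)"
    by (simp add: L1_norm_def case_prod_beta' nn_integral_distr)
  finally show ?thesis .
qed

text \<open>A continuous function on the compact closure is bounded, and bounded measurable
  functions are integrable for a finite measure. This supplies the first moments for the lower
  bound.\<close>

lemma continuous_on_closure_integrable:
  fixes f :: "'a::heine_borel \<Rightarrow> 'b::{banach, second_countable_topology}"
  assumes "bounded S" and "finite_measure M" and sets: "sets M = sets (restrict_space borel S)"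
    and cont: "continuous_on (closure S) f"
  shows "integrable M f"
proof -
  interpret finite_measure M by fact
  \<comment> \<open>Nothing is known of f outside the closure, so measurability is taken relative to
    S, which is also the space of M.\<close>
  have "f \<in> borel_measurable (restrict_space borel S)"
    by (intro borel_measurable_continuous_on_restrict continuous_on_subset[OF cont] closure_subset)
  then have "f \<in> borel_measurable M"
    by (simp add: measurable_cong_sets[OF sets refl])
  moreover have "bounded (f ` closure S)"
    using \<open>bounded S\<close> by (intro compact_imp_bounded compact_continuous_image[OF cont])
      (simp add: compact_closure)
  then obtain B where B: "\<And>x. x \<in> closure S \<Longrightarrow> norm (f x) \<le> B"
    by (auto simp: bounded_iff)
  have "space M = S"
    using sets_eq_imp_space_eq[OF sets] by (simp add: space_restrict_space)
  then have "AE x in M. norm (f x) \<le> B"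
    using B closure_subset by (intro AE_I2) blast
  ultimately show ?thesis
    by (intro integrable_const_bound) auto
qed

theorem corollary4:
  fixes \<Omega> :: "(real ^ 'd) set"
    and \<rho> :: "(real ^ 'd) measure"
    and f g :: "real ^ 'd \<Rightarrow> real"
    and \<mu> \<nu> :: "real measure"
  assumes "bounded \<Omega>" and "\<Omega> \<in> sets borel"
    and "prob_space \<rho>" and "sets \<rho> = sets (restrict_space borel \<Omega>)"
    and "continuous_on (closure \<Omega>) f" and "continuous_on (closure \<Omega>) g"
    and "\<mu> = distr \<rho> borel f" and "\<nu> = distr \<rho> borel g"
  shows "ennreal \<bar>(\<integral>x. f x \<partial>\<rho>) - (\<integral>x. g x \<partial>\<rho>)\<bar> \<le> wasserstein1 \<mu> \<nu> \<and>
         wasserstein1 \<mu> \<nu> \<le> L1_norm \<rho> (\<lambda>x. f x - g x) \<and>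
         ((AE x in \<rho>. f x \<ge> g x) \<longrightarrow> wasserstein1 \<mu> \<nu> = L1_norm \<rho> (\<lambda>x. f x - g x))"
proof -
  have fin: "finite_measure \<rho>"
    using assms(3) by (rule prob_space.finite_measure)
  have int: "integrable \<rho> f" "integrable \<rho> g"
    by (rule continuous_on_closure_integrable[OF assms(1) fin assms(4)]; fact)+
  note [measurable] = borel_measurable_integrable[OF int(1)] borel_measurable_integrable[OF int(2)]
  have "integrable \<mu> (\<lambda>x. x)" "integrable \<nu> (\<lambda>x. x)"
    unfolding assms(7,8) using int by (simp_all add: integrable_distr_eq)
  then have "ennreal \<bar>(\<integral>x. x \<partial>\<mu>) - (\<integral>x. x \<partial>\<nu>)\<bar> \<le> wasserstein1 \<mu> \<nu>"
    by (rule mean_diff_le_wasserstein1)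
  moreover have "(\<integral>x. x \<partial>\<mu>) = (\<integral>x. f x \<partial>\<rho>)" "(\<integral>x. x \<partial>\<nu>) = (\<integral>x. g x \<partial>\<rho>)"
    unfolding assms(7,8) by (rule integral_distr; measurable)+
  ultimately have lower: "ennreal \<bar>(\<integral>x. f x \<partial>\<rho>) - (\<integral>x. g x \<partial>\<rho>)\<bar> \<le> wasserstein1 \<mu> \<nu>"
    by simp
  have upper: "wasserstein1 \<mu> \<nu> \<le> L1_norm \<rho> (\<lambda>x. f x - g x)"
    unfolding assms(7,8) by (rule wasserstein1_distr_le_L1_norm; measurable)
  \<comment> \<open>Under the sign condition the absolute value disappears, so the L1 norm is the
    difference of the means, already bounded by \<open>lower\<close>.\<close>
  have "L1_norm \<rho> (\<lambda>x. f x - g x) \<le> wasserstein1 \<mu> \<nu>" if ge: "AE x in \<rho>. f x \<ge> g x"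
  proof -
    have "L1_norm \<rho> (\<lambda>x. f x - g x) = (\<integral>\<^sup>+ x. ennreal (f x - g x) \<partial>\<rho>)"
      unfolding L1_norm_def using ge by (intro nn_integral_cong_AE) auto
    \<comment> \<open>Nonnegativity almost everywhere and integrability let the
      \<open>ennreal\<close>-valued integral pass to the Bochner integral, where linearity
      applies.\<close>
    also have "\<dots> = ennreal (\<integral>x. f x - g x \<partial>\<rho>)"
      using int ge by (intro nn_integral_eq_integral) auto
    also have "\<dots> \<le> ennreal \<bar>(\<integral>x. f x \<partial>\<rho>) - (\<integral>x. g x \<partial>\<rho>)\<bar>"
      using int by (intro ennreal_leI) simp
    finally show ?thesis
      using lower by (rule order_trans)
  qed
  with lower upper show ?thesis
    by (auto intro: antisym)
qed

end
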